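(* Let $k$ be a fixed positive integer and let $n=rk$ with $r\to\infty$. Then a uniformly random permutation $\Pi_n$ of $[n]$ asymptotically almost surely contains $r$-twins of length $k$ with each twin in increasing order; that is, with probability tending to $1$ as $r\to\infty$, the positions $\{1,\dots,n\}$ can be partitioned into $r$ sets of size $k$ such that the entries of $\Pi_n$ at the positions of each set, read in order of position, form an increasing sequence.
   Context: For a permutation $\pi=(\pi_1,\dots,\pi_n)$, $r$-twins of length $k$ are $r$ pairwise disjoint subsequences of $\pi$, each of length $k$, which are pairwise similar, where two sequences $(a_1,\dots,a_k)$ and $(b_1,\dots,b_k)$ of distinct integers are similar if $a_i<a_j \iff b_i<b_j$ for all $1\le i<j\le k$. *)

theory Defs
  imports "HOL-Probability.Probability" "HOL-Combinatorics.Permutations"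
begin

(* A permutation of [n] is a function p with p permutes {1..n}, so p i is its i-th entry.
   A subsequence is given by the set A of its positions; its entries are read in order
   of position. *)
definition subseq_at :: "(nat \<Rightarrow> nat) \<Rightarrow> nat set \<Rightarrow> nat list" where
  "subseq_at p A = map p (sorted_list_of_set A)"

definition similar :: "nat list \<Rightarrow> nat list \<Rightarrow> bool" where
  "similar xs ys \<longleftrightarrow> length xs = length ys \<and>
     (\<forall>i j. i < j \<and> j < length xs \<longrightarrow> (xs ! i < xs ! j \<longleftrightarrow> ys ! i < ys ! j))"

(* For k > 0 disjoint position sets of size k are distinct, so a set of r position sets
   is the same as an unordered family of r subsequences. *)
definition twins :: "nat \<Rightarrow> (nat \<Rightarrow> nat) \<Rightarrow> nat \<Rightarrow> nat \<Rightarrow> nat set set \<Rightarrow> bool" where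
  "twins n p r k T \<longleftrightarrow> finite T \<and> card T = r \<and>
     (\<forall>A\<in>T. A \<subseteq> {1..n} \<and> card A = k) \<and>
     disjoint T \<and>
     (\<forall>A\<in>T. \<forall>B\<in>T. similar (subseq_at p A) (subseq_at p B))"

definition random_perm :: "nat \<Rightarrow> (nat \<Rightarrow> nat) pmf" where
  "random_perm n = pmf_of_set {p. p permutes {1..n}}"

end

theory Submission
  imports Defs "HOL-Real_Asymp.Real_Asymp"
begin

text \<open>
  The proof is by absorption. A random permutation has no decreasing subsequence longer than
  \<open>O(\<surd>n)\<close>, so by Erdos-Szekeres repeatedly removing increasing subsequences of length \<open>k\<close>
  exhausts any set of entries up to \<open>O(\<surd>n)\<close> of them; within a window of \<open>m\<close> positions or
  values only \<open>O(\<surd>m)\<close> entries are left over. Think of the permutation as \<open>n\<close> points in a square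
  and put \<open>a = n^0.8\<close>, \<open>b = n^0.45\<close>. Points outside the two anti-diagonal \<open>a \<times> a\<close> corners are
  comparable with all of the about \<open>n^0.6\<close> points of one of the diagonal \<open>a \<times> a\<close> corners, which
  therefore absorb a leftover of size \<open>O(\<surd>n)\<close>. Each of the \<open>O(n^0.4)\<close> leftover points of the
  anti-diagonal corners lies outside the (empty) anti-diagonal \<open>b \<times> b\<close> corners and so is comparable
  with about \<open>n^0.45\<close> points of a border strip of width \<open>b\<close>. The points of the diagonal corners that
  were not used leave over \<open>O(n^0.4)\<close> points, which are absorbed by a single increasing sequence of
  larger order in the middle of the square. What remains of that sequence has a length divisible by
  \<open>k\<close> because \<open>k\<close> divides \<open>n\<close>.
\<close>

section \<open>Partitions into increasing subsequences\<close>

text \<open>Testing size exactly \<open>l\<close> suffices: a larger decreasing set has decreasing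
  subsets of size \<open>l\<close>. As the empty set counts as decreasing, the property is false for
  \<open>l = 0\<close>, which explains the positivity conditions later.\<close>

definition no_decr :: "(nat \<Rightarrow> nat) \<Rightarrow> nat set \<Rightarrow> nat \<Rightarrow> bool" where
  "no_decr p A l \<longleftrightarrow> (\<forall>B\<subseteq>A. card B = l \<longrightarrow> \<not> (\<forall>i\<in>B. \<forall>j\<in>B. i < j \<longrightarrow> p j < p i))"

definition incr_on :: "(nat \<Rightarrow> nat) \<Rightarrow> nat set \<Rightarrow> bool" where
  "incr_on p A \<longleftrightarrow> (\<forall>i\<in>A. \<forall>j\<in>A. i < j \<longrightarrow> p i < p j)"

lemma incr_on_subset: "incr_on p A \<Longrightarrow> B \<subseteq> A \<Longrightarrow> incr_on p B"
  unfolding incr_on_def by blast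

lemma no_decr_subset: "no_decr p A l \<Longrightarrow> B \<subseteq> A \<Longrightarrow> no_decr p B l"
  unfolding no_decr_def by blast

text \<open>The witness is the largest size of an \<open>R\<close>-chain in \<open>A\<close> with last element \<open>i\<close>.\<close>

lemma longest_ending:
  fixes A :: "nat set" and R :: "nat \<Rightarrow> nat \<Rightarrow> bool" and i :: nat
  assumes "finite A"
    and bound: "\<And>B. B \<subseteq> A \<Longrightarrow> card B = m \<Longrightarrow> \<not> (\<forall>i\<in>B. \<forall>j\<in>B. i < j \<longrightarrow> R i j)"
    and trans: "\<And>i j k. R i j \<Longrightarrow> R j k \<Longrightarrow> R i k"
  obtains h where "\<And>i. i \<in> A \<Longrightarrow> h i \<in> {1..<m}"
    "\<And>i j. i \<in> A \<Longrightarrow> j \<in> A \<Longrightarrow> i < j \<Longrightarrow> R i j \<Longrightarrow> h i < (h j :: nat)"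
proof -
  define C where "C i = {B. B \<subseteq> A \<and> i \<in> B \<and> (\<forall>j\<in>B. j \<le> i) \<and> (\<forall>i\<in>B. \<forall>j\<in>B. i < j \<longrightarrow> R i j)}" for i
  define h where "h i = Max (card ` C i)" for i
  have fC: "finite (C i)" for i
    by (rule finite_subset[of _ "Pow A"]) (use assms(1) in \<open>auto simp: C_def\<close>)
  have single: "{i} \<in> C i" if "i \<in> A" for i using that by (auto simp: C_def)
  have ex: "\<exists>B\<in>C i. card B = h i" if "i \<in> A" for i
    using Max_in[of "card ` C i"] single[OF that] fC[of i] unfolding h_def by fastforce
  have ge: "card B \<le> h i" if "B \<in> C i" for B i
    unfolding h_def using that fC by (intro Max_ge) auto
  show thesis
  proof (rule that[of h])
    fix i assume i: "i \<in> A"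
    have "h i < m"
    proof (rule ccontr)
      assume "\<not> h i < m"
      obtain B where B: "B \<in> C i" "card B = h i" using ex[OF i] by blast
      obtain B' where "B' \<subseteq> B" "card B' = m" using obtain_subset_with_card_n[of m B] B \<open>\<not> h i < m\<close> by auto
      then show False using bound[of B'] B(1) unfolding C_def by blast
    qed
    then show "h i \<in> {1..<m}" using ge[OF single[OF i]] by simp
  next
    fix i j assume ij: "i \<in> A" "j \<in> A" "i < j" "R i j"
    \<comment> \<open>A largest chain ending at \<open>i\<close> can be prolonged by
      \<open>j\<close>: transitivity through \<open>i\<close> relates its other members to
      \<open>j\<close>.\<close>
    obtain B where B: "B \<in> C i" "card B = h i" using ex[OF ij(1)] by blast
    have R: "R x j" if "x \<in> B" for x
    proof (cases "x = i")
      case False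
      then have "x < i" using that B(1) by (fastforce simp: C_def)
      then show ?thesis using trans[OF _ ij(4)] that B(1) by (auto simp: C_def)
    qed (use ij in simp)
    have le: "x < j" if "x \<in> B" for x using that B(1) ij(3) by (fastforce simp: C_def)
    have "insert j B \<in> C j" using B(1) R ij(2) unfolding C_def
      by (auto dest!: le)
    moreover have "card (insert j B) = Suc (h i)"
    proof -
      have "finite B" using B(1) assms(1) finite_subset unfolding C_def by auto
      moreover have "j \<notin> B" using le by blast
      ultimately show ?thesis using B(2) by simp
    qed
    ultimately show "h i < h j" using ge by fastforce
  qed
qed

text \<open>If there is no increasing set of size \<open>k\<close>, label each position by the
  largest sizes of an increasing and of a decreasing set ending there. Of two positions the later
  one is larger in one of the labels, so the labelling is injective; but it takes values in a grid
  of (k-1)(l-1) cells.\<close>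

lemma erdos_szekeres:
  assumes "finite A" "inj_on p A" "no_decr p A l" "(k - 1) * (l - 1) < card A"
  shows "\<exists>B\<subseteq>A. card B = k \<and> incr_on p B"
proof (rule ccontr)
  assume no: "\<not> ?thesis"
  obtain f where f: "\<And>i. i \<in> A \<Longrightarrow> f i \<in> {1..<k}"
    "\<And>i j. i \<in> A \<Longrightarrow> j \<in> A \<Longrightarrow> i < j \<Longrightarrow> p i < p j \<Longrightarrow> f i < f j"
    by (rule longest_ending[of A k "\<lambda>i j. p i < p j"]) (use assms(1) no in \<open>auto simp: incr_on_def\<close>)
  obtain g where g: "\<And>i. i \<in> A \<Longrightarrow> g i \<in> {1..<l}"
    "\<And>i j. i \<in> A \<Longrightarrow> j \<in> A \<Longrightarrow> i < j \<Longrightarrow> p j < p i \<Longrightarrow> g i < g j"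
    by (rule longest_ending[of A l "\<lambda>i j. p j < p i"]) (use assms(1,3) in \<open>auto simp: no_decr_def\<close>)
  have neq: "(f i, g i) \<noteq> (f j, g j)" if "i \<in> A" "j \<in> A" "i < j" for i j
  proof -
    have "p i \<noteq> p j" using assms(2) that by (metis inj_onD less_irrefl)
    then show ?thesis using f(2)[OF that] g(2)[OF that] by fastforce
  qed
  have "inj_on (\<lambda>i. (f i, g i)) A"
    using neq by (intro linorder_inj_onI) auto
  then have "card A \<le> card ({1..<k} \<times> {1..<l})"
    by (rule card_inj_on_le) (use f(1) g(1) in auto)
  then show False using assms(4) by simp
qed

section \<open>Greedy tilings by increasing k-sets\<close>

definition tiled :: "(nat \<Rightarrow> nat) \<Rightarrow> nat \<Rightarrow> nat set \<Rightarrow> bool" where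
  "tiled p k A \<longleftrightarrow> (\<exists>F. partition_on A F \<and> (\<forall>X\<in>F. card X = k \<and> incr_on p X))"

lemma tiled_empty: "tiled p k {}"
  unfolding tiled_def by (rule exI[of _ "{}"]) (auto simp: partition_on_def)

lemma tiled_chain: "k > 0 \<Longrightarrow> card A = k \<Longrightarrow> incr_on p A \<Longrightarrow> tiled p k A"
  unfolding tiled_def by (rule exI[of _ "{A}"]) (auto intro!: partition_on_space)

lemma tiled_Un: "tiled p k A \<Longrightarrow> tiled p k B \<Longrightarrow> A \<inter> B = {} \<Longrightarrow> tiled p k (A \<union> B)"
  unfolding tiled_def
proof (elim exE conjE)
  fix F G assume "partition_on A F" "\<forall>X\<in>F. card X = k \<and> incr_on p X"
    "partition_on B G" "\<forall>X\<in>G. card X = k \<and> incr_on p X" and "A \<inter> B = {}"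
  then show "\<exists>F. partition_on (A \<union> B) F \<and> (\<forall>X\<in>F. card X = k \<and> incr_on p X)"
    by (intro exI[of _ "F \<union> G"]) (auto simp: partition_on_def intro: disjoint_union)
qed

lemma tiled_dvd:
  assumes "tiled p k A" "finite A"
  shows "k dvd card A"
proof -
  obtain F where F: "partition_on A F" "\<forall>X\<in>F. card X = k" using assms(1) unfolding tiled_def by blast
  have "card A = (\<Sum>X\<in>F. card X)"
    by (rule product_partition[OF F(1)])
      (use F(1) assms(2) in \<open>auto simp: partition_on_def intro: finite_subset\<close>)
  then show ?thesis using F(2) by simp
qed

text \<open>As long as more than (k-1)(l-1) entries remain, Erdos-Szekeres splits off one more
  increasing k-set; the bound on decreasing sets is inherited by what is left.\<close>

lemma tiled_all_but_few:
  assumes "finite A" "inj_on p A" "no_decr p A l" "k > 0"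
  shows "\<exists>S\<subseteq>A. tiled p k (A - S) \<and> card S \<le> (k - 1) * (l - 1)"
  using assms
proof (induction "card A" arbitrary: A rule: less_induct)
  case less
  show ?case
  proof (cases "card A \<le> (k - 1) * (l - 1)")
    case True
    then show ?thesis using tiled_empty by (intro exI[of _ A]) auto
  next
    case False
    obtain B where B: "B \<subseteq> A" "card B = k" "incr_on p B"
      using erdos_szekeres[OF less.prems(1-3)] False by (meson not_le)
    have "B \<noteq> {}" using B(2) less.prems(4) by auto
    then have "card (A - B) < card A" using B(1) less.prems(1)
      by (intro psubset_card_mono) auto
    then obtain S where S: "S \<subseteq> A - B" "tiled p k (A - B - S)" "card S \<le> (k - 1) * (l - 1)"
      using less.hyps[of "A - B"] less.prems inj_on_subset no_decr_subset by (metis Diff_subset finite_Diff)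
    have "tiled p k (B \<union> (A - B - S))"
      using tiled_chain[OF less.prems(4) B(2,3)] S by (intro tiled_Un) auto
    also have "B \<union> (A - B - S) = A - S" using S B by auto
    finally show ?thesis using S by auto
  qed
qed

lemma incr_on_inj_on: "incr_on p A \<Longrightarrow> inj_on p A"
  unfolding incr_on_def by (intro linorder_inj_onI) force+

lemma incr_on_no_decr:
  assumes "incr_on p A"
  shows "no_decr p A 2"
  unfolding no_decr_def
proof (intro allI impI notI)
  fix B assume B: "B \<subseteq> A" "card B = 2" "\<forall>i\<in>B. \<forall>j\<in>B. i < j \<longrightarrow> p j < p i"
  then obtain x y where "B = {x, y}" "x \<noteq> y" by (auto simp: card_2_iff)
  then show False using B assms unfolding incr_on_def
    by (metis insert_subset insertI1 insertI2 linorder_neqE_nat order_less_asym')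
qed

text \<open>An increasing set is the case \<open>l = 2\<close> of the greedy lemma, so at most k-1
  entries are left over, and divisibility makes this leftover empty.\<close>

lemma tiled_incr_on:
  assumes "finite A" "incr_on p A" "k dvd card A" "k > 0"
  shows "tiled p k A"
proof -
  note inj = incr_on_inj_on[OF assms(2)] and nd = incr_on_no_decr[OF assms(2)]
  obtain S where S: "S \<subseteq> A" "tiled p k (A - S)" "card S \<le> k - 1"
    using tiled_all_but_few[OF assms(1) inj nd assms(4)] by auto
  have fS: "finite S" using S assms finite_subset by blast
  have "card A = card (A - S) + card S" using S(1) assms(1) fS
    by (simp add: card_Diff_subset card_mono)
  then have "k dvd card S" using tiled_dvd[OF S(2)] assms by (metis dvd_add_right_iff finite_Diff)
  then have "card S = 0" using S(3) assms(4) by (cases "card S = 0") (auto dest: dvd_imp_le)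
  then have "S = {}" using fS by simp
  then show ?thesis using S(2) by simp
qed

section \<open>Absorption of leftover entries by a reservoir\<close>

definition absorbs :: "(nat \<Rightarrow> nat) \<Rightarrow> nat \<Rightarrow> nat set \<Rightarrow> nat \<Rightarrow> nat \<Rightarrow> bool" where
  "absorbs p k R N q \<longleftrightarrow>
    (\<forall>U. finite U \<longrightarrow> card U \<le> N \<longrightarrow> (\<exists>K\<subseteq>R-U. card K = k - 1 \<and> incr_on p (insert q K)))"

text \<open>The entries of \<open>S\<close> are served one after the other. In
  \<open>absorbs\<close> the set \<open>U\<close> stands for the reservoir entries already spent;
  each served entry costs k-1 of them, so the total spent never exceeds the budget (k-1)|S|.\<close>

lemma absorb_all:
  assumes "finite S" "finite R" "S \<inter> R = {}" "k > 0"
    and "\<And>q. q \<in> S \<Longrightarrow> absorbs p k R ((k - 1) * card S) q"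
  shows "\<exists>K\<subseteq>R. tiled p k (S \<union> K) \<and> card K = (k - 1) * card S"
proof -
  have "\<exists>K\<subseteq>R. tiled p k (T \<union> K) \<and> card K = (k - 1) * card T" if "T \<subseteq> S" for T
    using finite_subset[OF that assms(1)] that
  proof (induction T)
    case (insert q T)
    then obtain K where K: "K \<subseteq> R" "tiled p k (T \<union> K)" "card K = (k - 1) * card T" by auto
    have "card T \<le> card S" using insert assms(1) by (auto intro: card_mono)
    have fK: "finite K" using K(1) assms(2) finite_subset by blast
    from \<open>card T \<le> card S\<close> have "card K \<le> (k - 1) * card S" using K by simp
    then obtain K' where K': "K' \<subseteq> R - K" "card K' = k - 1" "incr_on p (insert q K')"
      using assms(5)[of q] insert.prems fK unfolding absorbs_def by blast
    have fin: "finite K" "finite K'" using K(1) K'(1) assms(2) finite_subset by (blast, meson Diff_subset finite_subset)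
    have "q \<notin> K'" "q \<notin> K" using insert.prems K' K assms(3) by auto
    then have "card (insert q K') = k" using K' assms(4) fin by simp
    then have t: "tiled p k (insert q K')" using K' assms(4) by (intro tiled_chain) auto
    have "tiled p k ((T \<union> K) \<union> insert q K')"
      by (rule tiled_Un[OF K(2) t]) (use insert assms(3) K K' \<open>q \<notin> K\<close> in auto)
    moreover have "(T \<union> K) \<union> insert q K' = insert q T \<union> (K \<union> K')" by auto
    moreover have "card (K \<union> K') = (k - 1) * card (insert q T)"
      using K K' fin insert.hyps by (subst card_Un_disjoint) auto
    ultimately show ?case using K K' by (intro exI[of _ "K \<union> K'"]) auto
  qed (auto intro: tiled_empty)
  then show ?thesis by blast
qed

text \<open>Removing \<open>U\<close> leaves at least k*l entries of \<open>B\<close>, enough for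
  Erdos-Szekeres to give an increasing k-set. One of its elements is discarded to make room for
  \<open>q\<close>, which lies below or above all the others in both position and value.\<close>

lemma absorbsI:
  assumes "finite B" "B \<subseteq> R" "inj_on p B" "no_decr p B l" "k * l + N \<le> card B" "k > 0" "l > 0"
    and comp: "(\<forall>i\<in>B. i < q \<and> p i < p q) \<or> (\<forall>i\<in>B. q < i \<and> p q < p i)"
  shows "absorbs p k R N q"
  unfolding absorbs_def
proof (intro allI impI)
  fix U :: "nat set" assume U: "finite U" "card U \<le> N"
  have "card B - card U \<le> card (B - U)" by (rule diff_card_le_card_Diff[OF U(1)])
  moreover have "(k - 1) * (l - 1) < k * l" using assms(6,7)
    by (intro mult_strict_mono) auto
  ultimately have "(k - 1) * (l - 1) < card (B - U)" using assms(5) U(2) by linarith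
  then obtain K where K: "K \<subseteq> B - U" "card K = k" "incr_on p K"
    using erdos_szekeres[OF finite_Diff[OF assms(1)] inj_on_subset[OF assms(3) Diff_subset]
      no_decr_subset[OF assms(4) Diff_subset]] by blast
  obtain K' where K': "K' \<subseteq> K" "card K' = k - 1"
    using obtain_subset_with_card_n[of "k - 1" K] unfolding K(2) by (metis diff_le_self)
  have "incr_on p (insert q K')"
  proof -
    have "(\<forall>i\<in>K'. i < q \<and> p i < p q) \<or> (\<forall>i\<in>K'. q < i \<and> p q < p i)"
      using comp K(1) K'(1) by blast
    then show ?thesis using incr_on_subset[OF K(3) K'(1)] unfolding incr_on_def
      by (metis insertE order_less_asym)
  qed
  then show "\<exists>K\<subseteq>R-U. card K = k - 1 \<and> incr_on p (insert q K)"
    using K(1) K' assms(2) by (intro exI[of _ K'] conjI) blast+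
qed

lemma absorbs_mono: "absorbs p k R N q \<Longrightarrow> N' \<le> N \<Longrightarrow> absorbs p k R N' q"
  unfolding absorbs_def by (meson order_trans)

text \<open>The deterministic core. The cardinality hypotheses are budgets: a reservoir needs
  \<open>k\<close> times its own bound on decreasing sets for \<open>absorbsI\<close>, plus
  \<open>k\<close> for every leftover point it serves (at most \<open>k * ln\<close> points in
  \<open>cR\<close>, at most \<open>2 * (k * la)\<close> in \<open>cV\<close> and
  \<open>cM\<close>). What a stage does not use of its reservoir is tiled later: the rest of
  \<open>V\<close> as part of \<open>W\<close>, the rest of \<open>R1\<close> and \<open>R2\<close>
  in the third stage, the rest of \<open>D\<close> by divisibility. The condition
  \<open>3 * c \<le> n\<close> separates the middle \<open>M\<close> from both margins of width
  \<open>a\<close>.\<close>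

lemma tiled_atLeastAtMost:
  fixes n k a b c la lb ln :: nat and p :: "nat \<Rightarrow> nat"
  defines "M \<equiv> {c<..2 * c}"
  assumes p: "p permutes {1..n}" and k: "k > 0" "k dvd n"
    and abc: "b \<le> a" "a \<le> c" "3 * c \<le> n"
    and pos: "la > 0" "lb > 0" "ln > 0"
    and dn: "no_decr p {1..n} ln"
    and da: "no_decr p {1..a} la" "no_decr p {n - a<..n} la"
    and db: "no_decr p {1..b} lb" "no_decr p {n - b<..n} lb"
      "no_decr p {i\<in>{1..n}. p i \<in> {1..b}} lb" "no_decr p {i\<in>{1..n}. p i \<in> {n - b<..n}} lb"
    and box: "\<not> (\<exists>i\<in>{1..b}. p i \<in> {n - b<..n})" "\<not> (\<exists>i\<in>{n - b<..n}. p i \<in> {1..b})"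
    and cR: "k * la + k * (k * ln) \<le> card {i\<in>{1..a}. p i \<in> {1..a}}"
      "k * la + k * (k * ln) \<le> card {i\<in>{n - a<..n}. p i \<in> {n - a<..n}}"
    and cV: "k * lb + k * (2 * (k * la)) \<le> card {i\<in>{1..b}. p i \<in> M}"
      "k * lb + k * (2 * (k * la)) \<le> card {i\<in>{n - b<..n}. p i \<in> M}"
      "k * lb + k * (2 * (k * la)) \<le> card {i\<in>M. p i \<in> {1..b}}"
      "k * lb + k * (2 * (k * la)) \<le> card {i\<in>M. p i \<in> {n - b<..n}}"
    and cM: "(k * 2 + k * (2 * (k * la))) * ln < card {i\<in>M. p i \<in> M}"
  shows "tiled p k {1..n}"
proof -
  txt \<open>In the plot of \<open>p\<close>, \<open>Q1\<close>, \<open>Q2\<close> are the points in the two anti-diagonal corners and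
    \<open>R1\<close>, \<open>R2\<close> those in the diagonal ones; \<open>V1\<close>, \<open>V2\<close>, \<open>V3\<close>, \<open>V4\<close> lie in the middle of the
    left, right, bottom and top border strips of width \<open>b\<close>.\<close>
  define Q1 where "Q1 = {i\<in>{1..a}. p i \<in> {n - a<..n}}"
  define Q2 where "Q2 = {i\<in>{n - a<..n}. p i \<in> {1..a}}"
  define R1 where "R1 = {i\<in>{1..a}. p i \<in> {1..a}}"
  define R2 where "R2 = {i\<in>{n - a<..n}. p i \<in> {n - a<..n}}"
  define V1 where "V1 = {i\<in>{1..b}. p i \<in> M}"
  define V2 where "V2 = {i\<in>{n - b<..n}. p i \<in> M}"
  define V3 where "V3 = {i\<in>M. p i \<in> {1..b}}"
  define V4 where "V4 = {i\<in>M. p i \<in> {n - b<..n}}"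
  define V where "V = V1 \<union> V2 \<union> V3 \<union> V4"
  note defs = Q1_def Q2_def R1_def R2_def V1_def V2_def V3_def V4_def M_def
  have inj: "inj_on p A" for A using permutes_inj_on[OF p] .
  have range: "1 \<le> p i \<and> p i \<le> n" if "1 \<le> i" "i \<le> n" for i
    using permutes_in_image[OF p, of i] that by simp
  have sub: "Q1 \<subseteq> {1..n}" "Q2 \<subseteq> {1..n}" "R1 \<subseteq> {1..n}" "R2 \<subseteq> {1..n}" "V \<subseteq> {1..n}"
    using abc by (auto simp: defs V_def)
  have fin: "finite Q1" "finite Q2" "finite R1" "finite R2" "finite V"
    using sub finite_subset by blast+
  have fV: "finite V1" "finite V2" "finite V3" "finite V4" using fin(5) by (auto simp: V_def)
  have disj: "Q1 \<inter> Q2 = {}" "(Q1 \<union> Q2) \<inter> (R1 \<union> R2) = {}" "R1 \<inter> R2 = {}"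
    "V \<inter> (Q1 \<union> Q2 \<union> R1 \<union> R2) = {}"
    using abc by (auto simp: defs V_def)
  have chop: "\<exists>S\<subseteq>A. tiled p k (A - S) \<and> card S \<le> k * l" if A: "finite A" "no_decr p A l" for A l
  proof -
    have "(k - 1) * (l - 1) \<le> k * l" by (intro mult_le_mono) auto
    then show ?thesis using tiled_all_but_few[OF A(1) inj A(2) k(1)] by (meson order_trans)
  qed

  \<comment> \<open>\<open>D\<close> is increasing, so \<open>absorbsI\<close> will be applied to it
    with \<open>l = 2\<close>: this accounts for \<open>k * 2\<close>, and the second summand pays
    for the leftover of the diagonal corners.\<close>
  obtain D where D: "D \<subseteq> {i\<in>M. p i \<in> M}" "card D = k * 2 + k * (2 * (k * la))" "incr_on p D"
  proof -
    have "(k * 2 + k * (2 * (k * la)) - 1) * (ln - 1) \<le> (k * 2 + k * (2 * (k * la))) * ln"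
      by (intro mult_le_mono) auto
    then have "(k * 2 + k * (2 * (k * la)) - 1) * (ln - 1) < card {i\<in>M. p i \<in> M}"
      using cM by linarith
    moreover have "no_decr p {i\<in>M. p i \<in> M} ln"
      by (rule no_decr_subset[OF dn]) (use abc in \<open>auto simp: M_def\<close>)
    moreover have "finite {i\<in>M. p i \<in> M}" by (simp add: M_def)
    ultimately show thesis using erdos_szekeres[OF _ inj] that by blast
  qed
  have subD: "D \<subseteq> {1..n}" using D(1) abc by (auto simp: M_def)
  have fD: "finite D" using subD finite_subset by blast
  have disjD: "D \<inter> (Q1 \<union> Q2 \<union> R1 \<union> R2 \<union> V) = {}" using D(1) abc by (fastforce simp: defs V_def)

  have "no_decr p Q1 la" "no_decr p Q2 la" "no_decr p R1 la" "no_decr p R2 la"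
    using da by (auto intro: no_decr_subset simp: defs)
  note ndQ = this
  obtain SQ1 where SQ1: "SQ1 \<subseteq> Q1" "tiled p k (Q1 - SQ1)" "card SQ1 \<le> k * la"
    using chop[OF fin(1) ndQ(1)] by blast
  obtain SQ2 where SQ2: "SQ2 \<subseteq> Q2" "tiled p k (Q2 - SQ2)" "card SQ2 \<le> k * la"
    using chop[OF fin(2) ndQ(2)] by blast
  have cSQ: "card (SQ1 \<union> SQ2) \<le> 2 * (k * la)"
    using SQ1(3) SQ2(3) card_Un_le[of SQ1 SQ2] by linarith
  have ndV: "no_decr p V1 lb" "no_decr p V2 lb" "no_decr p V3 lb" "no_decr p V4 lb"
    using abc by (auto intro: no_decr_subset[OF db(1)] no_decr_subset[OF db(2)]
      no_decr_subset[OF db(3)] no_decr_subset[OF db(4)] simp: defs)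
  have abV: "absorbs p k V (k * (2 * (k * la))) q" if q: "q \<in> Q1 \<union> Q2" for q
  proof -
    have ab: "absorbs p k V (k * (2 * (k * la))) q"
      if "B \<in> {V1, V2, V3, V4}" "(\<forall>i\<in>B. i < q \<and> p i < p q) \<or> (\<forall>i\<in>B. q < i \<and> p q < p i)" for B
      by (rule absorbsI[of B V p lb]) (use that fV inj ndV cV pos k in \<open>auto simp: V_def V1_def V2_def V3_def V4_def\<close>)
    \<comment> \<open>A point of \<open>Q1\<close> to the right of the left strip lies above and to
      the right of \<open>V1\<close>. Otherwise the empty top left box keeps its value out of the
      top strip, so it lies below and to the left of \<open>V4\<close>. The cases of
      \<open>Q2\<close> mirror this with \<open>V2\<close> and \<open>V3\<close>.\<close>
    consider "q \<in> Q1" "q > b" | "q \<in> Q1" "q \<le> b" | "q \<in> Q2" "q \<le> n - b" | "q \<in> Q2" "q > n - b" using q by fastforce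
    then show ?thesis
    proof cases
      case 1
      then have "\<forall>i\<in>V1. i < q \<and> p i < p q" using abc by (auto simp: defs)
      then show ?thesis using ab by blast
    next
      case 2
      then have "q \<in> {1..b}" "p q \<le> n" by (auto simp: Q1_def)
      then have "p q \<le> n - b" using box(1) by force
      then have "\<forall>i\<in>V4. q < i \<and> p q < p i" using 2 abc by (auto simp: defs)
      then show ?thesis using ab by blast
    next
      case 3
      then have "\<forall>i\<in>V2. q < i \<and> p q < p i" using abc by (auto simp: defs)
      then show ?thesis using ab by blast
    next
      case 4
      then have "p q > b" using box(2) abc by (auto simp: defs)
      then have "\<forall>i\<in>V3. i < q \<and> p i < p q" using 4 abc by (auto simp: defs)
      then show ?thesis using ab by blast
    qed
  qed
  have "\<exists>K\<subseteq>V. tiled p k ((SQ1 \<union> SQ2) \<union> K) \<and> card K = (k - 1) * card (SQ1 \<union> SQ2)"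
  proof (rule absorb_all)
    show "finite (SQ1 \<union> SQ2)" using finite_subset[OF SQ1(1) fin(1)] finite_subset[OF SQ2(1) fin(2)] by simp
    show "(SQ1 \<union> SQ2) \<inter> V = {}" using SQ1(1) SQ2(1) disj by blast
    show "absorbs p k V ((k - 1) * card (SQ1 \<union> SQ2)) q" if "q \<in> SQ1 \<union> SQ2" for q
      proof (rule absorbs_mono[OF abV])
      show "q \<in> Q1 \<union> Q2" using that SQ1(1) SQ2(1) by blast
      show "(k - 1) * card (SQ1 \<union> SQ2) \<le> k * (2 * (k * la))"
        using cSQ by (intro mult_le_mono) auto
    qed
  qed (use fin k in auto)
  then obtain KQ where KQ: "KQ \<subseteq> V" "tiled p k ((SQ1 \<union> SQ2) \<union> KQ)" by blast
  have "tiled p k (((Q1 - SQ1) \<union> (Q2 - SQ2)) \<union> ((SQ1 \<union> SQ2) \<union> KQ))"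
    by (rule tiled_Un[OF tiled_Un[OF SQ1(2) SQ2(2)] KQ(2)]) (use SQ1(1) SQ2(1) KQ(1) disj in blast)+
  moreover have "((Q1 - SQ1) \<union> (Q2 - SQ2)) \<union> ((SQ1 \<union> SQ2) \<union> KQ) = Q1 \<union> Q2 \<union> KQ"
    using SQ1(1) SQ2(1) by blast
  ultimately have tQ: "tiled p k (Q1 \<union> Q2 \<union> KQ)" by simp

  \<comment> \<open>The second stage covers all points outside the four corners, including the part
    of \<open>V\<close> not spent on \<open>Q1\<close> and \<open>Q2\<close>, but holds back
    \<open>D\<close> for the end.\<close>
  define W where "W = {1..n} - (Q1 \<union> Q2 \<union> KQ \<union> R1 \<union> R2 \<union> D)"
  have "finite W" "no_decr p W ln" by (simp add: W_def, rule no_decr_subset[OF dn], simp add: W_def)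
  then obtain S1 where S1: "S1 \<subseteq> W" "tiled p k (W - S1)" "card S1 \<le> k * ln"
    using chop by blast
  have abR: "absorbs p k (R1 \<union> R2) (k * (k * ln)) q" if q: "q \<in> W" for q
  proof -
    have ab: "absorbs p k (R1 \<union> R2) (k * (k * ln)) q"
      if "B \<in> {R1, R2}" "(\<forall>i\<in>B. i < q \<and> p i < p q) \<or> (\<forall>i\<in>B. q < i \<and> p q < p i)" for B
      by (rule absorbsI[of B _ p la]) (use that fin inj ndQ cR pos k in \<open>auto simp: R1_def R2_def\<close>)
    have q': "1 \<le> q" "q \<le> n" "q \<notin> Q1" "q \<notin> Q2" using q by (auto simp: W_def)
    \<comment> \<open>If one coordinate of the point is at most \<open>a\<close>, the other is at
      most \<open>n - a\<close>, since the point is in neither anti-diagonal corner.\<close>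
    then have "(a < q \<and> a < p q) \<or> (q \<le> n - a \<and> p q \<le> n - a)"
      using range[OF q'(1,2)] abc by (auto simp: defs)
    then have "(\<forall>i\<in>R1. i < q \<and> p i < p q) \<or> (\<forall>i\<in>R2. q < i \<and> p q < p i)"
      by (auto simp: defs)
    then show ?thesis using ab by blast
  qed
  have "\<exists>K\<subseteq>R1 \<union> R2. tiled p k (S1 \<union> K) \<and> card K = (k - 1) * card S1"
  proof (rule absorb_all)
    show "finite S1" using S1(1) \<open>finite W\<close> finite_subset by blast
    show "S1 \<inter> (R1 \<union> R2) = {}" using S1(1) unfolding W_def by blast
    show "absorbs p k (R1 \<union> R2) ((k - 1) * card S1) q" if "q \<in> S1" for q
      proof (rule absorbs_mono[OF abR])
      show "q \<in> W" using that S1(1) by blast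
      show "(k - 1) * card S1 \<le> k * (k * ln)" using S1(3) by (intro mult_le_mono) auto
    qed
  qed (use fin k in auto)
  then obtain K1 where K1: "K1 \<subseteq> R1 \<union> R2" "tiled p k (S1 \<union> K1)" by blast
  have "tiled p k ((W - S1) \<union> (S1 \<union> K1))"
    by (rule tiled_Un[OF S1(2) K1(2)]) (use S1(1) K1(1) W_def in blast)
  moreover have "(W - S1) \<union> (S1 \<union> K1) = W \<union> K1" using S1(1) by blast
  ultimately have tW: "tiled p k (W \<union> K1)" by simp

  \<comment> \<open>Third stage: the points of the diagonal corners not spent on \<open>W\<close>
    are tiled greedily, and \<open>D\<close> absorbs what remains of them.\<close>
  have "finite (R1 - K1)" "no_decr p (R1 - K1) la" using fin ndQ by (auto intro: no_decr_subset)
  then obtain S21 where S21: "S21 \<subseteq> R1 - K1" "tiled p k (R1 - K1 - S21)" "card S21 \<le> k * la"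
    using chop by blast
  have "finite (R2 - K1)" "no_decr p (R2 - K1) la" using fin ndQ by (auto intro: no_decr_subset)
  then obtain S22 where S22: "S22 \<subseteq> R2 - K1" "tiled p k (R2 - K1 - S22)" "card S22 \<le> k * la"
    using chop by blast
  have cS2: "card (S21 \<union> S22) \<le> 2 * (k * la)"
    using S21(3) S22(3) card_Un_le[of S21 S22] by linarith
  have abD: "absorbs p k D (k * (2 * (k * la))) q" if q: "q \<in> R1 \<union> R2" for q
  proof (rule absorbsI[OF fD order_refl inj incr_on_no_decr[OF D(3)]])
    show "(\<forall>i\<in>D. i < q \<and> p i < p q) \<or> (\<forall>i\<in>D. q < i \<and> p q < p i)"
      using q
    proof
      assume "q \<in> R1"
      then have "\<forall>i\<in>D. q < i \<and> p q < p i" using D(1) abc by (fastforce simp: defs)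
      then show ?thesis ..
    next
      assume "q \<in> R2"
      then have "\<forall>i\<in>D. i < q \<and> p i < p q" using D(1) abc by (fastforce simp: defs)
      then show ?thesis ..
    qed
  qed (use D(2) k in auto)
  have "\<exists>K\<subseteq>D. tiled p k ((S21 \<union> S22) \<union> K) \<and> card K = (k - 1) * card (S21 \<union> S22)"
  proof (rule absorb_all)
    show "finite (S21 \<union> S22)" using S21(1) S22(1) fin by (meson finite_Diff finite_UnI finite_subset)
    show "(S21 \<union> S22) \<inter> D = {}" using S21(1) S22(1) disjD by blast
    show "absorbs p k D ((k - 1) * card (S21 \<union> S22)) q" if "q \<in> S21 \<union> S22" for q
      proof (rule absorbs_mono[OF abD])
      show "q \<in> R1 \<union> R2" using that S21(1) S22(1) by blast
      show "(k - 1) * card (S21 \<union> S22) \<le> k * (2 * (k * la))"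
        using cS2 by (intro mult_le_mono) auto
    qed
  qed (use fD k in auto)
  then obtain K2 where K2: "K2 \<subseteq> D" "tiled p k ((S21 \<union> S22) \<union> K2)" by blast
  have "tiled p k (((R1 - K1 - S21) \<union> (R2 - K1 - S22)) \<union> ((S21 \<union> S22) \<union> K2))"
    by (rule tiled_Un[OF tiled_Un[OF S21(2) S22(2)] K2(2)]) (use S21(1) S22(1) K2(1) disj disjD in blast)+
  moreover have "((R1 - K1 - S21) \<union> (R2 - K1 - S22)) \<union> ((S21 \<union> S22) \<union> K2) = ((R1 \<union> R2) - K1) \<union> K2"
    using S21(1) S22(1) by blast
  ultimately have tR: "tiled p k (((R1 \<union> R2) - K1) \<union> K2)" by simp

  define U where "U = ((Q1 \<union> Q2 \<union> KQ) \<union> (W \<union> K1)) \<union> (((R1 \<union> R2) - K1) \<union> K2)"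
  have tU: "tiled p k U" unfolding U_def
    by (rule tiled_Un[OF tiled_Un[OF tQ tW] tR]) (use K1(1) K2(1) KQ(1) disj disjD W_def in blast)+
  have Un: "{1..n} = U \<union> (D - K2)"
  proof
    show "{1..n} \<subseteq> U \<union> (D - K2)" unfolding U_def W_def by blast
    have "W \<subseteq> {1..n}" by (auto simp: W_def)
    moreover have "KQ \<subseteq> {1..n}" "K1 \<subseteq> {1..n}" "K2 \<subseteq> {1..n}"
      using sub subD K1(1) K2(1) KQ(1) by blast+
    ultimately show "U \<union> (D - K2) \<subseteq> {1..n}"
      using sub subD unfolding U_def by (intro Un_least) blast+
  qed
  then have fU: "finite U" by (metis finite_Un finite_atLeastAtMost)
  have dUD: "U \<inter> (D - K2) = {}"
  proof -
    have "W \<inter> D = {}" by (auto simp: W_def)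
    then show ?thesis using disjD K1(1) KQ(1) unfolding U_def by blast
  qed
  \<comment> \<open>Only \<open>D - K2\<close> is left. As \<open>k\<close> divides both
    \<open>n\<close> and the size of the tiled set \<open>U\<close>, it divides the size of this
    increasing set.\<close>
  have "n = card (U \<union> (D - K2))" unfolding Un[symmetric] by simp
  then have n: "n = card U + card (D - K2)"
    using card_Un_disjoint[OF fU finite_Diff[OF fD] dUD] by simp
  have "k dvd card U + card (D - K2)" using subst[OF n, of "\<lambda>x. k dvd x"] k(2) .
  then have "k dvd card (D - K2)" by (rule dvd_add_right_iff[OF tiled_dvd[OF tU fU], THEN iffD1])
  then have "tiled p k (D - K2)"
    by (rule tiled_incr_on[OF finite_Diff[OF fD] incr_on_subset[OF D(3) Diff_subset] _ k(1)])
  then have "tiled p k (U \<union> (D - K2))" by (rule tiled_Un[OF tU _ dUD])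
  then show ?thesis using Un by simp
qed

section \<open>Random permutations\<close>

definition whp :: "(nat \<Rightarrow> (nat \<Rightarrow> nat) \<Rightarrow> bool) \<Rightarrow> bool" where
  "whp E \<longleftrightarrow> (\<lambda>n. measure_pmf.prob (random_perm n) {p. \<not> E n p}) \<longlonglongrightarrow> 0"

lemma whp_conj:
  assumes "whp E" "whp F"
  shows "whp (\<lambda>n p. E n p \<and> F n p)"
proof -
  have s: "(\<lambda>n. measure_pmf.prob (random_perm n) {p. \<not> E n p} + measure_pmf.prob (random_perm n) {p. \<not> F n p}) \<longlonglongrightarrow> 0"
    using tendsto_add[OF assms[unfolded whp_def]] by simp
  show ?thesis unfolding whp_def
  proof (rule tendsto_sandwich[OF _ _ tendsto_const s])
    show "\<forall>\<^sub>F n in sequentially. measure_pmf.prob (random_perm n) {p. \<not> (E n p \<and> F n p)}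
      \<le> measure_pmf.prob (random_perm n) {p. \<not> E n p} + measure_pmf.prob (random_perm n) {p. \<not> F n p}"
    proof (rule always_eventually, rule allI)
      fix n
      have "{p. \<not> (E n p \<and> F n p)} = {p. \<not> E n p} \<union> {p. \<not> F n p}" by auto
      then show "measure_pmf.prob (random_perm n) {p. \<not> (E n p \<and> F n p)}
      \<le> measure_pmf.prob (random_perm n) {p. \<not> E n p} + measure_pmf.prob (random_perm n) {p. \<not> F n p}"
        by (simp add: measure_Un_le)
    qed
  qed auto
qed

lemma whp_bound:
  assumes "\<forall>\<^sub>F n in sequentially. measure_pmf.prob (random_perm n) {p. \<not> E n p} \<le> g n" "g \<longlonglongrightarrow> 0"
  shows "whp E"
  unfolding whp_def
  by (rule tendsto_sandwich[OF _ assms(1) tendsto_const assms(2)]) auto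

section \<open>Upper bounds from the symmetry of the uniform distribution\<close>

abbreviation perms :: "nat \<Rightarrow> (nat \<Rightarrow> nat) set" where
  "perms n \<equiv> {p. p permutes {1..n}}"

lemma perms_finite_nonempty: "finite (perms n)" "perms n \<noteq> {}"
  using finite_permutations[of "{1..n}"] permutes_id[of "{1..n}"] by blast+

lemma prob_random_perm:
  "measure_pmf.prob (random_perm n) E = card (perms n \<inter> E) / fact n"
  unfolding random_perm_def
  by (subst measure_pmf_of_set) (use perms_finite_nonempty[of n] card_permutations[of "{1..n}" n] in auto)

lemma set_random_perm: "set_pmf (random_perm n) = perms n"
  unfolding random_perm_def using perms_finite_nonempty by simp

lemma bij_betw_compose_left_permutes:
  assumes "s permutes {1..n}"
  shows "bij_betw (\<lambda>p. s \<circ> p) (perms n) (perms n)"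
  by (rule bij_betw_byWitness[where f' = "\<lambda>p. inv s \<circ> p"])
    (use assms in \<open>auto simp: o_assoc permutes_inv_o intro!: permutes_compose permutes_inv\<close>)

lemma bij_betw_compose_right_permutes:
  assumes "s permutes {1..n}"
  shows "bij_betw (\<lambda>p. p \<circ> s) (perms n) (perms n)"
  by (rule bij_betw_byWitness[where f' = "\<lambda>p. p \<circ> inv s"])
    (use assms in \<open>auto simp: o_assoc[symmetric] permutes_inv_o intro!: permutes_compose permutes_inv\<close>)

text \<open>The preimages of \<open>E\<close> under the maps \<open>g s\<close> are disjoint and equally likely.\<close>

lemma prob_le_of_orbit:
  assumes "finite S" "S \<noteq> {}"
    and bij: "\<And>s. s \<in> S \<Longrightarrow> bij_betw (g s) (perms n) (perms n)"
    and disj: "\<And>s t p. s \<in> S \<Longrightarrow> t \<in> S \<Longrightarrow> p permutes {1..n} \<Longrightarrow> g s p \<in> E \<Longrightarrow> g t p \<in> E \<Longrightarrow> s = t"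
  shows "measure_pmf.prob (random_perm n) E \<le> 1 / card S"
proof -
  define F where "F s = {p \<in> perms n. g s p \<in> E}" for s
  have cF: "card (F s) = card (perms n \<inter> E)" if "s \<in> S" for s
  proof -
    have "bij_betw (g s) (F s) (perms n \<inter> E)"
      using bij[OF that] unfolding bij_betw_def F_def inj_on_def by (auto 0 3)
    then show ?thesis by (rule bij_betw_same_card)
  qed
  have "card S * card (perms n \<inter> E) = (\<Sum>s\<in>S. card (F s))" using cF by simp
  also have "\<dots> = card (\<Union>s\<in>S. F s)"
    by (rule card_UN_disjoint[symmetric]) (use assms(1) disj perms_finite_nonempty in \<open>auto simp: F_def\<close>)
  also have "\<dots> \<le> card (perms n)"
    by (rule card_mono) (use perms_finite_nonempty in \<open>auto simp: F_def\<close>)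
  also have "\<dots> = fact n" using card_permutations[of "{1..n}" n] by simp
  finally have "real (card S * card (perms n \<inter> E)) \<le> fact n"
    by (metis of_nat_fact of_nat_le_iff)
  moreover have "card S > 0" using assms by (simp add: card_gt_0_iff)
  ultimately show ?thesis
    by (simp add: prob_random_perm field_simps)
qed

text \<open>After composition with the transposition of \<open>j\<close> and \<open>s\<close> the
  event reads \<open>p i = s\<close>; these n events are disjoint.\<close>

lemma prob_fix1_le:
  assumes "i \<in> {1..n}" "j \<in> {1..n}"
  shows "measure_pmf.prob (random_perm n) {p. p i = j} \<le> 1 / n"
proof -
  have "measure_pmf.prob (random_perm n) {p. p i = j} \<le> 1 / card {1..n}"
  proof (rule prob_le_of_orbit[where g = "\<lambda>s p. Transposition.transpose j s \<circ> p"])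
    show "bij_betw (\<lambda>p. Transposition.transpose j s \<circ> p) (perms n) (perms n)" if "s \<in> {1..n}" for s
      using assms that by (intro bij_betw_compose_left_permutes permutes_swap_id)
  next
    fix s t p assume "s \<in> {1..n}" "t \<in> {1..n}" "p permutes {1..n}"
      "Transposition.transpose j s \<circ> p \<in> {p. p i = j}" "Transposition.transpose j t \<circ> p \<in> {p. p i = j}"
    then show "s = t" by (auto simp: Transposition.transpose_def split: if_splits)
  qed (use assms in auto)
  then show ?thesis by simp
qed

lemma prob_fix2_le:
  assumes "i \<in> {1..n}" "j \<in> {1..n}" "i' \<in> {1..n}" "j' \<in> {1..n}" "i \<noteq> i'" "j \<noteq> j'"
  shows "measure_pmf.prob (random_perm n) {p. p i = j \<and> p i' = j'} \<le> 1 / real (n * (n - 1))"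
proof -
  define S where "S = Sigma {1..n} (\<lambda>s. {1..n} - {s})"
  \<comment> \<open>\<open>h (s, t)\<close> is a permutation that sends \<open>s\<close> to
    \<open>j\<close> and \<open>t\<close> to \<open>j'\<close>: the first transposition moves
    \<open>s\<close> to \<open>j\<close>, and the second moves the image of \<open>t\<close> to
    \<open>j'\<close> without touching \<open>j\<close>, because \<open>s \<noteq> t\<close> and
    \<open>j \<noteq> j'\<close>.\<close>
  define h where "h = (\<lambda>(s,t). Transposition.transpose j' (Transposition.transpose j s t) \<circ> Transposition.transpose j s)"
  have h: "h s permutes {1..n} \<and> h s (fst s) = j \<and> h s (snd s) = j'" if s: "s \<in> S" for s
  proof -
    obtain u v where uv: "s = (u,v)" "u \<in> {1..n}" "v \<in> {1..n}" "u \<noteq> v" using s unfolding S_def by blast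
    have "Transposition.transpose j u v \<in> {1..n}" using uv assms by (auto simp: Transposition.transpose_def)
    then have "h s permutes {1..n}" unfolding h_def uv(1) split
      by (intro permutes_compose permutes_swap_id) (use assms uv in auto)
    moreover have "h s u = j \<and> h s v = j'" unfolding h_def uv(1) split
      using assms uv by (auto simp: Transposition.transpose_def)
    ultimately show ?thesis using uv by simp
  qed
  have "measure_pmf.prob (random_perm n) {p. p i = j \<and> p i' = j'} \<le> 1 / card S"
  proof (rule prob_le_of_orbit[where g = "\<lambda>s p. h s \<circ> p"])
    show "finite S" unfolding S_def by auto
    have "(i, i') \<in> S" using assms by (simp add: S_def)
    then show "S \<noteq> {}" by blast
    show "bij_betw (\<lambda>p. h s \<circ> p) (perms n) (perms n)" if "s \<in> S" for s
      using h[OF that] by (intro bij_betw_compose_left_permutes) auto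
  next
    fix s t p assume st: "s \<in> S" "t \<in> S" "p permutes {1..n}"
      "h s \<circ> p \<in> {p. p i = j \<and> p i' = j'}" "h t \<circ> p \<in> {p. p i = j \<and> p i' = j'}"
    have "p i = fst s" "p i' = snd s" "p i = fst t" "p i' = snd t"
      using h[OF st(1)] h[OF st(2)] st(4,5) by (simp_all, (metis permutes_inj inj_eq)+)
    then show "s = t" by (simp add: prod_eq_iff)
  qed
  moreover have "card S = n * (n - 1)" unfolding S_def by (simp add: card_SigmaI)
  ultimately show ?thesis by simp
qed

text \<open>The orbit consists of all rearrangements of the entries at the positions in
  \<open>B\<close>; at most one of them is decreasing.\<close>

lemma prob_decreasing_le:
  assumes "B \<subseteq> {1..n}"
  shows "measure_pmf.prob (random_perm n) {p. \<forall>i\<in>B. \<forall>j\<in>B. i < j \<longrightarrow> p j < p i} \<le> 1 / fact (card B)"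
proof -
  have fB: "finite B" using assms finite_subset by blast
  have "measure_pmf.prob (random_perm n) {p. \<forall>i\<in>B. \<forall>j\<in>B. i < j \<longrightarrow> p j < p i} \<le> 1 / card {s. s permutes B}"
  proof (rule prob_le_of_orbit[where g = "\<lambda>s p. p \<circ> s"])
    show "bij_betw (\<lambda>p. p \<circ> s) (perms n) (perms n)" if "s \<in> {s. s permutes B}" for s
      using that assms permutes_subset[of s B "{1..n}"] by (intro bij_betw_compose_right_permutes) auto
  next
    fix s t p
    assume st: "s \<in> {s. s permutes B}" "t \<in> {s. s permutes B}" "p permutes {1..n}"
      "p \<circ> s \<in> {p. \<forall>i\<in>B. \<forall>j\<in>B. i < j \<longrightarrow> p j < p i}"
      "p \<circ> t \<in> {p. \<forall>i\<in>B. \<forall>j\<in>B. i < j \<longrightarrow> p j < p i}"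
    have sorted: "sorted_wrt (<) (rev (map (p \<circ> u) (sorted_list_of_set B)))"
      if "p \<circ> u \<in> {p. \<forall>i\<in>B. \<forall>j\<in>B. i < j \<longrightarrow> p j < p i}" for u
    proof -
      have "sorted_wrt (\<lambda>x y. (p \<circ> u) y < (p \<circ> u) x) (sorted_list_of_set B)"
        by (rule sorted_wrt_mono_rel[OF _ strict_sorted_list_of_set]) (use that fB in auto)
      then show ?thesis unfolding sorted_wrt_rev sorted_wrt_map .
    qed
    have img: "(p \<circ> u) ` B = p ` B" if "u permutes B" for u
      using permutes_image[OF that] by (metis image_comp)
    have "rev (map (p \<circ> s) (sorted_list_of_set B)) = rev (map (p \<circ> t) (sorted_list_of_set B))"
      by (rule strict_sorted_equal[OF sorted[OF st(5)] sorted[OF st(4)]])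
        (use st fB img[of s] img[of t] in simp)
    then have "\<forall>x\<in>B. p (s x) = p (t x)" using fB by simp
    then have "\<forall>x\<in>B. s x = t x" using st(3) by (metis permutes_inj inj_eq)
    moreover have "\<forall>x. x \<notin> B \<longrightarrow> s x = t x" using st(1,2) by (auto simp: permutes_def)
    ultimately show "s = t" by auto
  qed (use fB finite_permutations permutes_id in blast)+
  then show ?thesis using card_permutations[OF refl fB] by simp
qed

lemma prob_not_no_decr_le:
  assumes "I \<subseteq> {1..n}"
  shows "measure_pmf.prob (random_perm n) {p. \<not> no_decr p I l} \<le> (card I choose l) / fact l"
proof -
  define S where "S = {B. B \<subseteq> I \<and> card B = l}"
  define E where "E B = {p::nat\<Rightarrow>nat. \<forall>i\<in>B. \<forall>j\<in>B. i < j \<longrightarrow> p j < p i}" for B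
  have fI: "finite I" using assms finite_subset by blast
  then have fS: "finite S" unfolding S_def by auto
  have "{p. \<not> no_decr p I l} = (\<Union>B\<in>S. E B)" by (auto simp: no_decr_def S_def E_def)
  then have "measure_pmf.prob (random_perm n) {p. \<not> no_decr p I l} \<le> (\<Sum>B\<in>S. measure_pmf.prob (random_perm n) (E B))"
    using measure_pmf.finite_measure_subadditive_finite[OF fS, of E] by simp
  also have "\<dots> \<le> (\<Sum>B\<in>S. 1 / fact l)"
  proof (rule sum_mono)
    fix B assume "B \<in> S"
    then show "measure_pmf.prob (random_perm n) (E B) \<le> 1 / fact l"
      using prob_decreasing_le[of B n] assms unfolding E_def S_def by auto
  qed
  also have "\<dots> = (card I choose l) / fact l"
    using n_subsets[OF fI] by (simp add: S_def)
  finally show ?thesis .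
qed

lemma map_inv_random_perm: "map_pmf inv (random_perm n) = random_perm n"
proof -
  have b: "bij_betw inv (perms n) (perms n)"
    by (rule bij_betw_byWitness[where f' = inv])
      (auto simp: permutes_inv permutes_inv_inv)
  show ?thesis unfolding random_perm_def
    by (rule map_pmf_of_set_bij_betw[OF b perms_finite_nonempty(2,1)])
qed

text \<open>Inversion preserves the uniform distribution. It reflects the plot in the diagonal,
  which swaps positions with values and maps decreasing sets to decreasing sets.\<close>

lemma prob_values_not_no_decr_le:
  assumes "J \<subseteq> {1..n}"
  shows "measure_pmf.prob (random_perm n) {p. \<not> no_decr p {i\<in>{1..n}. p i \<in> J} l} \<le> (card J choose l) / fact l"
proof -
  have "measure_pmf.prob (random_perm n) {p. \<not> no_decr p {i\<in>{1..n}. p i \<in> J} l}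
      \<le> measure_pmf.prob (random_perm n) (inv -` {p. \<not> no_decr p J l})"
  proof (rule measure_pmf.finite_measure_mono_AE)
    show "AE p in random_perm n. p \<in> {p. \<not> no_decr p {i\<in>{1..n}. p i \<in> J} l} \<longrightarrow> p \<in> inv -` {p. \<not> no_decr p J l}"
      unfolding AE_measure_pmf_iff set_random_perm
    proof (intro ballI impI)
      fix p assume p: "p \<in> perms n" and "p \<in> {p. \<not> no_decr p {i\<in>{1..n}. p i \<in> J} l}"
      then obtain B where B: "B \<subseteq> {i\<in>{1..n}. p i \<in> J}" "card B = l" "\<forall>i\<in>B. \<forall>j\<in>B. i < j \<longrightarrow> p j < p i"
        unfolding no_decr_def by blast
      have inj: "inj p" using p permutes_inj by blast
      have "\<not> no_decr (inv p) J l" unfolding no_decr_def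
      proof (clarsimp, intro exI conjI)
        show "p ` B \<subseteq> J" using B by auto
        show "card (p ` B) = l" using B card_image inj by (metis inj_on_subset subset_UNIV)
        show "\<forall>i\<in>p ` B. \<forall>j\<in>p ` B. i < j \<longrightarrow> inv p j < inv p i"
          using B(3) inv_f_f[OF inj] by (auto, metis linorder_neqE_nat order_less_asym')
      qed
      then show "p \<in> inv -` {p. \<not> no_decr p J l}" by simp
    qed
  qed auto
  also have "\<dots> = measure_pmf.prob (random_perm n) {p. \<not> no_decr p J l}"
    by (subst map_inv_random_perm[symmetric]) (simp only: measure_map_pmf)
  also have "\<dots> \<le> (card J choose l) / fact l" by (rule prob_not_no_decr_le[OF assms])
  finally show ?thesis .
qed

section \<open>Number of entries in a box: first and second moments\<close>

lemma prob_value_in_le: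
  assumes "i \<in> {1..n}" "J \<subseteq> {1..n}"
  shows "measure_pmf.prob (random_perm n) {p. p i \<in> J} \<le> card J / n"
proof -
  have fJ: "finite J" using assms finite_subset by blast
  have "{p. p i \<in> J} = (\<Union>j\<in>J. {p. p i = j})" by auto
  then have "measure_pmf.prob (random_perm n) {p. p i \<in> J} \<le> (\<Sum>j\<in>J. measure_pmf.prob (random_perm n) {p. p i = j})"
    using measure_pmf.finite_measure_subadditive_finite[OF fJ, of "\<lambda>j. {p. p i = j}"] by simp
  also have "\<dots> \<le> (\<Sum>j\<in>J. 1 / n)"
    using assms by (intro sum_mono prob_fix1_le) auto
  finally show ?thesis by simp
qed

text \<open>Orbits give only upper bounds; the lower bound comes from the upper bound for the
  complementary set of values.\<close>

lemma prob_value_in_ge: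
  assumes "i \<in> {1..n}" "J \<subseteq> {1..n}"
  shows "measure_pmf.prob (random_perm n) {p. p i \<in> J} \<ge> card J / n"
proof -
  have fJ: "finite J" using assms finite_subset by blast
  have "1 = measure_pmf.prob (random_perm n) ({p. p i \<in> J} \<union> {p. p i \<in> {1..n} - J})"
  proof (rule measure_pmf.prob_eq_1[THEN iffD2, symmetric])
    show "AE p in random_perm n. p \<in> {p. p i \<in> J} \<union> {p. p i \<in> {1..n} - J}"
      unfolding AE_measure_pmf_iff set_random_perm using assms(1) permutes_in_image by fastforce
  qed auto
  also have "\<dots> \<le> measure_pmf.prob (random_perm n) {p. p i \<in> J} + measure_pmf.prob (random_perm n) {p. p i \<in> {1..n} - J}"
    by (rule measure_Un_le) auto
  also have "measure_pmf.prob (random_perm n) {p. p i \<in> {1..n} - J} \<le> card ({1..n} - J) / n"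
    by (rule prob_value_in_le) (use assms in auto)
  also have "card ({1..n} - J) / n = 1 - card J / n"
    using assms card_mono[OF _ assms(2)] by (simp add: card_Diff_subset fJ of_nat_diff field_simps)
  finally show ?thesis by simp
qed

text \<open>Negative correlation of sampling without replacement: with m = |J| there are m(m-1)
  pairs of distinct values, and (m-1)/(n-1) is at most m/n because m is at most n.\<close>

lemma prob_two_values_in_le:
  assumes "i \<in> {1..n}" "i' \<in> {1..n}" "i \<noteq> i'" "J \<subseteq> {1..n}"
  shows "measure_pmf.prob (random_perm n) {p. p i \<in> J \<and> p i' \<in> J} \<le> (card J / n)\<^sup>2"
proof -
  have fJ: "finite J" using assms finite_subset by blast
  define S where "S = Sigma J (\<lambda>s. J - {s})"
  have fS: "finite S" using fJ by (auto simp: S_def)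
  have n: "n \<ge> 2" using assms by auto
  have "measure_pmf.prob (random_perm n) {p. p i \<in> J \<and> p i' \<in> J}
      \<le> measure_pmf.prob (random_perm n) (\<Union>s\<in>S. {p. p i = fst s \<and> p i' = snd s})"
  proof (rule measure_pmf.finite_measure_mono_AE)
    show "AE p in random_perm n. p \<in> {p. p i \<in> J \<and> p i' \<in> J} \<longrightarrow> p \<in> (\<Union>s\<in>S. {p. p i = fst s \<and> p i' = snd s})"
      unfolding AE_measure_pmf_iff set_random_perm S_def
      using assms(3) by (auto dest: permutes_inj simp: inj_eq)
  qed auto
  also have "\<dots> \<le> (\<Sum>s\<in>S. measure_pmf.prob (random_perm n) {p. p i = fst s \<and> p i' = snd s})"
    using measure_pmf.finite_measure_subadditive_finite[OF fS, of "\<lambda>s. {p. p i = fst s \<and> p i' = snd s}"] by simp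
  also have "\<dots> \<le> (\<Sum>s\<in>S. 1 / real (n * (n - 1)))"
  proof (rule sum_mono)
    fix s assume "s \<in> S"
    then have "fst s \<in> {1..n}" "snd s \<in> {1..n}" "fst s \<noteq> snd s"
      using assms(4) by (auto simp: S_def)
    then show "measure_pmf.prob (random_perm n) {p. p i = fst s \<and> p i' = snd s} \<le> 1 / real (n * (n - 1))"
      using prob_fix2_le[OF assms(1) _ assms(2) _ assms(3)] by blast
  qed
  also have "\<dots> = card J * (card J - 1) / (n * (n - 1))"
    using fJ by (simp add: S_def card_SigmaI)
  also have "\<dots> \<le> (card J / n)\<^sup>2"
  proof (cases "card J = 0")
    case False
    have c: "card J \<le> n" using card_mono[OF _ assms(4)] by simp
    have "real (card J - 1) / real (n - 1) \<le> card J / n"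
      using c n False by (simp add: divide_simps of_nat_diff algebra_simps)
    then have "card J / n * (real (card J - 1) / real (n - 1)) \<le> card J / n * (card J / n)"
      by (rule mult_left_mono) simp
    then show ?thesis by (simp add: power2_eq_square)
  qed simp
  finally show ?thesis .
qed

lemma integrable_random_perm [simp]:
  "integrable (measure_pmf (random_perm n)) (f :: _ \<Rightarrow> real)"
  by (rule integrable_measure_pmf_finite, unfold set_random_perm, rule perms_finite_nonempty)

text \<open>Chebyshev's inequality for the count \<open>X\<close>, centred at \<open>\<mu>\<close>.
  Off-diagonal pairs contribute at most the square of \<open>\<mu>\<close> to the second moment and
  the diagonal adds at most \<open>\<mu>\<close>, so the mean square deviation is at most
  \<open>\<mu>\<close>; a deviation of half of \<open>\<mu>\<close> then has probability at most 4 /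
  \<open>\<mu>\<close>.\<close>

lemma prob_few_values_le:
  assumes "I \<subseteq> {1..n}" "J \<subseteq> {1..n}"
  shows "measure_pmf.prob (random_perm n) {p. real (card {i\<in>I. p i \<in> J}) < card I * card J / (2 * n)}
    \<le> 4 * n / (card I * card J)"
proof (cases "card I * card J = 0")
  \<comment> \<open>The threshold is 0, so the event is empty, and the right-hand side is 0 by the
    convention for division by zero.\<close>
  case True
  then show ?thesis by auto
next
  case False
  have fI: "finite I" using assms finite_subset by blast
  define \<mu> where "\<mu> = card I * card J / n"
  define M where "M = measure_pmf (random_perm n)"
  define Y where "Y i p = (indicator {p. p i \<in> J} p :: real)" for i :: nat and p :: "nat \<Rightarrow> nat"
  define X where "X p = (\<Sum>i\<in>I. Y i p)" for p
  have n: "n > 0" using False assms by (cases n) auto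
  have mu: "\<mu> > 0" using False n by (simp add: \<mu>_def)
  have X: "X p = card {i\<in>I. p i \<in> J}" for p
    using fI by (simp add: X_def Y_def indicator_def sum.If_cases Int_def)
  have int [simp]: "integrable M f" for f :: "_ \<Rightarrow> real" by (simp add: M_def)
  have EY: "integral\<^sup>L M (Y i) = measure M {p. p i \<in> J}" for i
    unfolding Y_def M_def by simp
  have "integral\<^sup>L M X = (\<Sum>i\<in>I. measure M {p. p i \<in> J})"
    unfolding X_def by (simp add: EY)
  also have "\<dots> \<ge> (\<Sum>i\<in>I. card J / n)"
    unfolding M_def using assms by (intro sum_mono prob_value_in_ge) auto
  finally have EX: "integral\<^sup>L M X \<ge> \<mu>" by (simp add: \<mu>_def)
  have YY: "Y i p * Y i' p = indicator {p. p i \<in> J \<and> p i' \<in> J} p" for i i' p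
    by (simp add: Y_def indicator_def)
  have "integral\<^sup>L M (\<lambda>p. (X p)\<^sup>2) = (\<Sum>i\<in>I. \<Sum>i'\<in>I. measure M {p. p i \<in> J \<and> p i' \<in> J})"
    unfolding X_def power2_eq_square sum_product by (simp add: YY, simp add: M_def)
  also have "\<dots> \<le> (\<Sum>i\<in>I. \<Sum>i'\<in>I. (card J / n)\<^sup>2 + (if i = i' then card J / n else 0))"
  proof (intro sum_mono)
    fix i i' assume i: "i \<in> I" "i' \<in> I"
    show "measure M {p. p i \<in> J \<and> p i' \<in> J} \<le> (card J / n)\<^sup>2 + (if i = i' then card J / n else 0)"
    proof (cases "i = i'")
      case True
      then show ?thesis using prob_value_in_le[of i n J] i assms
        by (auto simp: M_def subset_iff intro!: add_increasing)
    next
      case False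
      then show ?thesis using prob_two_values_in_le[of i n i' J] i assms by (auto simp: M_def subset_iff)
    qed
  qed
  also have "\<dots> = \<mu>\<^sup>2 + \<mu>"
    using fI by (simp add: \<mu>_def sum.distrib power2_eq_square algebra_simps)
  finally have EX2: "integral\<^sup>L M (\<lambda>p. (X p)\<^sup>2) \<le> \<mu>\<^sup>2 + \<mu>" .
  have "integral\<^sup>L M (\<lambda>p. (X p - \<mu>)\<^sup>2) = integral\<^sup>L M (\<lambda>p. (X p)\<^sup>2) - 2 * \<mu> * integral\<^sup>L M X + \<mu>\<^sup>2"
    by (simp add: power2_diff M_def algebra_simps)
  \<comment> \<open>The mean enters with a negative sign, so the lower bound \<open>EX\<close> is
    the one required.\<close>
  also have "\<dots> \<le> \<mu>\<^sup>2 + \<mu> - 2 * \<mu> * \<mu> + \<mu>\<^sup>2"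
    using EX2 mult_left_mono[OF EX, of "2 * \<mu>"] mu by linarith
  finally have V: "integral\<^sup>L M (\<lambda>p. (X p - \<mu>)\<^sup>2) \<le> \<mu>" by (simp add: power2_eq_square)
  have "measure M {p. X p < \<mu> / 2} \<le> measure M {p. (\<mu> / 2)\<^sup>2 \<le> (X p - \<mu>)\<^sup>2}"
    unfolding M_def
  proof (rule measure_pmf.finite_measure_mono)
    show "{p. X p < \<mu> / 2} \<subseteq> {p. (\<mu> / 2)\<^sup>2 \<le> (X p - \<mu>)\<^sup>2}"
    proof clarify
      fix p assume "X p < \<mu> / 2"
      then have "(\<mu> / 2)\<^sup>2 \<le> (\<mu> - X p)\<^sup>2" using mu by (intro power_mono) auto
      then show "(\<mu> / 2)\<^sup>2 \<le> (X p - \<mu>)\<^sup>2" by (simp add: power2_commute)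
    qed
  qed auto
  also have "\<dots> \<le> integral\<^sup>L M (\<lambda>p. (X p - \<mu>)\<^sup>2) / (\<mu> / 2)\<^sup>2"
    using integral_Markov_inequality_measure[of M "\<lambda>p. (X p - \<mu>)\<^sup>2" "{}" "(\<mu> / 2)\<^sup>2"] mu
    by (simp add: M_def)
  also have "\<dots> \<le> \<mu> / (\<mu> / 2)\<^sup>2" using V by (intro divide_right_mono) auto
  also have "\<dots> = 4 * n / (card I * card J)"
    using mu by (simp add: power2_eq_square \<mu>_def)
  also have "{p. X p < \<mu> / 2} = {p. real (card {i\<in>I. p i \<in> J}) < card I * card J / (2 * n)}"
    by (simp add: X \<mu>_def mult.commute)
  finally show ?thesis unfolding M_def by simp
qed

lemma prob_some_value_le:
  assumes "I \<subseteq> {1..n}" "J \<subseteq> {1..n}"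
  shows "measure_pmf.prob (random_perm n) {p. \<exists>i\<in>I. p i \<in> J} \<le> card I * card J / n"
proof -
  have fI: "finite I" using assms finite_subset by blast
  have "{p. \<exists>i\<in>I. p i \<in> J} = (\<Union>i\<in>I. {p. p i \<in> J})" by auto
  then have "measure_pmf.prob (random_perm n) {p. \<exists>i\<in>I. p i \<in> J} \<le> (\<Sum>i\<in>I. measure_pmf.prob (random_perm n) {p. p i \<in> J})"
    using measure_pmf.finite_measure_subadditive_finite[OF fI, of "\<lambda>i. {p. p i \<in> J}"] by simp
  also have "\<dots> \<le> (\<Sum>i\<in>I. card J / n)"
    using assms by (intro sum_mono prob_value_in_le) auto
  finally show ?thesis by simp
qed

section \<open>Numerical bound for long decreasing sets\<close>

lemma fact_ge_power: "real l ^ l / exp 1 ^ l \<le> fact l"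
proof -
  \<comment> \<open>A single term of the exponential series at \<open>l\<close>.\<close>
  have "(\<Sum>j\<in>{l}. real l ^ j / fact j) \<le> exp (real l)"
    using sum_le_suminf[OF summable_exp[of "real l"], of "{l}"]
    by (simp add: exp_def field_simps)
  then have "real l ^ l / fact l \<le> exp 1 ^ l" by (simp add: exp_of_nat_mult[symmetric])
  then show ?thesis by (simp add: field_simps)
qed

text \<open>Since \<open>(m choose l) / l! \<le> (e\<^sup>2 m / l\<^sup>2)^l\<close>, any factor larger than \<open>e\<close> would do in place of 6.\<close>

definition decr_bound :: "nat \<Rightarrow> nat" where
  "decr_bound m = nat \<lceil>6 * sqrt m\<rceil>"

text \<open>Both factorials are bounded below by (l/e)^l. With e at most 3 and l at least 6 sqrt(m),
  the base e^2 m / l^2 is at most 9/36.\<close>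

lemma binomial_over_fact_le:
  assumes "m > 0"
  shows "(m choose decr_bound m) / fact (decr_bound m) \<le> (1 / 4) ^ decr_bound m"
proof -
  define l where "l = decr_bound m"
  have l: "real l \<ge> 6 * sqrt m" by (simp add: l_def decr_bound_def)
  then have l0: "real l > 0" using assms by (smt (verit) of_nat_0_less_iff real_sqrt_gt_zero)
  have "real (m choose l) \<le> m ^ l / fact l"
  proof (cases "l \<le> m")
    case True
    have "fact l * (m choose l) \<le> m ^ l"
      using binomial_fact_pow by (simp add: mult.commute)
    then have "real (fact l * (m choose l)) \<le> real (m ^ l)" by (rule of_nat_mono)
    then show ?thesis by (simp add: field_simps)
  qed (simp add: binomial_eq_0)
  then have "(m choose l) / fact l \<le> m ^ l / fact l / fact l"
    by (rule divide_right_mono) simp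
  also have "\<dots> = m ^ l / (fact l)\<^sup>2" by (simp add: power2_eq_square)
  also have "\<dots> \<le> m ^ l / (real l ^ l / exp 1 ^ l)\<^sup>2"
    using l0 by (intro divide_left_mono power_mono fact_ge_power) auto
  also have "\<dots> = (m * (exp 1)\<^sup>2 / (real l)\<^sup>2) ^ l"
    by (simp add: power_mult_distrib power_divide power_mult[symmetric] mult.commute)
  also have "\<dots> \<le> (1 / 4) ^ l"
  proof (rule power_mono)
    have "(6 * sqrt m)\<^sup>2 \<le> (real l)\<^sup>2" using l by (intro power_mono) auto
    then have "36 * m \<le> (real l)\<^sup>2" by (simp add: power_mult_distrib)
    moreover have "(exp (1::real))\<^sup>2 \<le> 3\<^sup>2" using exp_le by (intro power_mono) auto
    then have "m * (exp (1::real))\<^sup>2 \<le> real m * 9" by (intro mult_left_mono) auto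
    ultimately show "m * (exp 1)\<^sup>2 / (real l)\<^sup>2 \<le> 1 / 4" using l0 by (simp add: field_simps)
  qed auto
  finally show ?thesis unfolding l_def .
qed

section \<open>Almost sure partitions\<close>

lemma decr_bound_at_top: "filterlim decr_bound at_top at_top"
  unfolding decr_bound_def by real_asymp

lemma whp_mono:
  assumes "whp E" "\<forall>\<^sub>F n in sequentially. \<forall>p. p permutes {1..n} \<longrightarrow> E n p \<longrightarrow> F n p"
  shows "whp F"
proof (rule whp_bound)
  show "\<forall>\<^sub>F n in sequentially. measure_pmf.prob (random_perm n) {p. \<not> F n p}
      \<le> measure_pmf.prob (random_perm n) {p. \<not> E n p}"
    using assms(2)
  proof eventually_elim
    case (elim n)
    then show ?case
      by (intro measure_pmf.finite_measure_mono_AE) (auto simp: AE_measure_pmf_iff set_random_perm)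
  qed
qed (use assms(1) whp_def in blast)

lemma quarter_power_decr_bound:
  assumes "filterlim m at_top sequentially"
  shows "(\<lambda>n. (1 / 4 :: real) ^ decr_bound (m n)) \<longlonglongrightarrow> 0"
  by (rule filterlim_compose[OF LIMSEQ_power_zero filterlim_compose[OF decr_bound_at_top assms]]) simp

lemma whp_no_decr:
  assumes "\<And>n. I n \<subseteq> {1..n}" and at_top: "filterlim (\<lambda>n. card (I n)) at_top sequentially"
  shows "whp (\<lambda>n p. no_decr p (I n) (decr_bound (card (I n))))"
proof (rule whp_bound[OF _ quarter_power_decr_bound[OF at_top]])
  have "\<forall>\<^sub>F n in sequentially. card (I n) > 0"
    by (rule eventually_compose_filterlim[OF eventually_gt_at_top at_top])
  then show "\<forall>\<^sub>F n in sequentially. measure_pmf.prob (random_perm n)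
      {p. \<not> no_decr p (I n) (decr_bound (card (I n)))} \<le> (1 / 4) ^ decr_bound (card (I n))"
    by eventually_elim (blast intro: order_trans[OF prob_not_no_decr_le[OF assms(1)] binomial_over_fact_le])
qed

lemma whp_values_no_decr:
  assumes "\<And>n. J n \<subseteq> {1..n}" and at_top: "filterlim (\<lambda>n. card (J n)) at_top sequentially"
  shows "whp (\<lambda>n p. no_decr p {i\<in>{1..n}. p i \<in> J n} (decr_bound (card (J n))))"
proof (rule whp_bound[OF _ quarter_power_decr_bound[OF at_top]])
  have "\<forall>\<^sub>F n in sequentially. card (J n) > 0"
    by (rule eventually_compose_filterlim[OF eventually_gt_at_top at_top])
  then show "\<forall>\<^sub>F n in sequentially. measure_pmf.prob (random_perm n)
      {p. \<not> no_decr p {i\<in>{1..n}. p i \<in> J n} (decr_bound (card (J n)))} \<le> (1 / 4) ^ decr_bound (card (J n))"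
    by eventually_elim (blast intro: order_trans[OF prob_values_not_no_decr_le[OF assms(1)] binomial_over_fact_le])
qed

lemma whp_many_values:
  assumes "\<And>n. I n \<subseteq> {1..n}" "\<And>n. J n \<subseteq> {1..n}"
    and at_top: "filterlim (\<lambda>n. card (I n) * card (J n) / n) at_top sequentially"
  shows "whp (\<lambda>n p. card (I n) * card (J n) / (2 * n) \<le> card {i\<in>I n. p i \<in> J n})"
proof (rule whp_bound)
  show "\<forall>\<^sub>F n in sequentially. measure_pmf.prob (random_perm n)
      {p. \<not> card (I n) * card (J n) / (2 * n) \<le> card {i\<in>I n. p i \<in> J n}}
      \<le> 4 * inverse (card (I n) * card (J n) / n)"
    using prob_few_values_le[OF assms(1,2)] by (simp add: not_le field_simps)
  show "(\<lambda>n. 4 * inverse (card (I n) * card (J n) / n)) \<longlonglongrightarrow> 0"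
    using tendsto_mult[OF tendsto_const[of 4] filterlim_compose[OF tendsto_inverse_0_at_top[OF filterlim_ident] at_top]]
    by simp
qed

lemma whp_no_value:
  assumes "\<And>n. I n \<subseteq> {1..n}" "\<And>n. J n \<subseteq> {1..n}"
    and "(\<lambda>n. card (I n) * card (J n) / n) \<longlonglongrightarrow> 0"
  shows "whp (\<lambda>n p. \<not> (\<exists>i\<in>I n. p i \<in> J n))"
  by (rule whp_bound[OF always_eventually assms(3)])
    (use prob_some_value_le[OF assms(1,2)] in simp)

text \<open>The exponents \<open>\<alpha> > \<beta>\<close> of \<open>wide\<close> and \<open>narrow\<close> have to satisfy \<open>2 \<alpha> - 1 > 1 / 2\<close> (the diagonal
  corners absorb \<open>O(\<surd>n)\<close> entries), \<open>\<beta> > \<alpha> / 2\<close> (the strips absorb the leftover of the anti-diagonal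
  corners) and \<open>\<beta> < 1 / 2\<close> (the small anti-diagonal corners are empty).\<close>

definition wide :: "nat \<Rightarrow> nat" where
  "wide n = nat \<lfloor>real n powr (4 / 5)\<rfloor>"

definition narrow :: "nat \<Rightarrow> nat" where
  "narrow n = nat \<lfloor>real n powr (9 / 20)\<rfloor>"

lemma powr_floor_le:
  assumes "0 < \<alpha>" "\<alpha> \<le> 1"
  shows "nat \<lfloor>real n powr \<alpha>\<rfloor> \<le> n"
proof (cases "n = 0")
  case False
  then have "real n powr \<alpha> \<le> real n powr 1" using assms by (intro powr_mono) auto
  then show ?thesis by (simp add: nat_le_iff floor_le_iff)
qed simp

lemma wide_le: "wide n \<le> n" and narrow_le: "narrow n \<le> n"
  unfolding wide_def narrow_def by (simp_all add: powr_floor_le)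

text \<open>The hypotheses of \<open>tiled_atLeastAtMost\<close> hold with high probability for
  \<open>a = wide n\<close>, \<open>b = narrow n\<close>, \<open>c = n div 3\<close> and the bounds
  \<open>decr_bound\<close>. Divisibility is a premise inside the event because \<open>whp\<close>
  runs over all \<open>n\<close>.\<close>

lemma whp_tiled:
  fixes k :: nat
  assumes k: "k > 0"
  shows "whp (\<lambda>n p. k dvd n \<longrightarrow> tiled p k {1..n})"
proof -
  let ?M = "\<lambda>n. {n div 3<..2 * (n div 3)}"
  let ?lo = "\<lambda>n. {1..wide n}" and ?hi = "\<lambda>n. {n - wide n<..n}"
  let ?Lo = "\<lambda>n. {1..narrow n}" and ?Hi = "\<lambda>n. {n - narrow n<..n}"
  have card: "card (?M n) = n div 3" "card (?lo n) = wide n" "card (?hi n) = wide n"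
    "card (?Lo n) = narrow n" "card (?Hi n) = narrow n" "card {1..n} = n" for n
    using wide_le[of n] narrow_le[of n] by auto
  have sub: "?M n \<subseteq> {1..n}" "?lo n \<subseteq> {1..n}" "?hi n \<subseteq> {1..n}"
    "?Lo n \<subseteq> {1..n}" "?Hi n \<subseteq> {1..n}" "{1..n} \<subseteq> {1..n}" for n
    using wide_le[of n] narrow_le[of n] by auto
  have lim: "filterlim wide at_top at_top" "filterlim narrow at_top at_top"
    unfolding wide_def narrow_def by real_asymp+
  \<comment> \<open>The expected counts have orders n^0.6, n^0.45, n^0.45, n and n^(-0.1).\<close>
  have lim_card: "filterlim (\<lambda>n::nat. wide n * wide n / n) at_top at_top"
    "filterlim (\<lambda>n::nat. narrow n * (n div 3) / n) at_top at_top"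
    "filterlim (\<lambda>n::nat. (n div 3) * narrow n / n) at_top at_top"
    "filterlim (\<lambda>n::nat. (n div 3) * (n div 3) / n) at_top at_top"
    "(\<lambda>n. narrow n * narrow n / n) \<longlonglongrightarrow> 0"
    unfolding wide_def narrow_def by real_asymp+
  let ?long = "\<lambda>(n::nat) p. no_decr p {1..n} (decr_bound n)
    \<and> no_decr p (?lo n) (decr_bound (wide n)) \<and> no_decr p (?hi n) (decr_bound (wide n))
    \<and> no_decr p (?Lo n) (decr_bound (narrow n)) \<and> no_decr p (?Hi n) (decr_bound (narrow n))
    \<and> no_decr p {i\<in>{1..n}. p i \<in> ?Lo n} (decr_bound (narrow n))
    \<and> no_decr p {i\<in>{1..n}. p i \<in> ?Hi n} (decr_bound (narrow n))"
  let ?box = "\<lambda>(n::nat) p. \<not> (\<exists>i\<in>?Lo n. p i \<in> ?Hi n) \<and> \<not> (\<exists>i\<in>?Hi n. p i \<in> ?Lo n)"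
  let ?wide = "\<lambda>(n::nat) p. wide n * wide n / (2 * n) \<le> card {i\<in>?lo n. p i \<in> ?lo n}
    \<and> wide n * wide n / (2 * n) \<le> card {i\<in>?hi n. p i \<in> ?hi n}"
  let ?narrow = "\<lambda>(n::nat) p. narrow n * (n div 3) / (2 * n) \<le> card {i\<in>?Lo n. p i \<in> ?M n}
    \<and> narrow n * (n div 3) / (2 * n) \<le> card {i\<in>?Hi n. p i \<in> ?M n}
    \<and> (n div 3) * narrow n / (2 * n) \<le> card {i\<in>?M n. p i \<in> ?Lo n}
    \<and> (n div 3) * narrow n / (2 * n) \<le> card {i\<in>?M n. p i \<in> ?Hi n}"
  let ?mid = "\<lambda>(n::nat) p. (n div 3) * (n div 3) / (2 * n) \<le> card {i\<in>?M n. p i \<in> ?M n}"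
  have long: "whp ?long"
    using whp_no_decr[of "\<lambda>n. {1..n}", unfolded card, OF sub(6) filterlim_ident]
      whp_no_decr[of ?lo, unfolded card, OF sub(2) lim(1)]
      whp_no_decr[of ?hi, unfolded card, OF sub(3) lim(1)]
      whp_no_decr[of ?Lo, unfolded card, OF sub(4) lim(2)]
      whp_no_decr[of ?Hi, unfolded card, OF sub(5) lim(2)]
      whp_values_no_decr[of ?Lo, unfolded card, OF sub(4) lim(2)]
      whp_values_no_decr[of ?Hi, unfolded card, OF sub(5) lim(2)]
    by (intro whp_conj)
  have box: "whp ?box"
    using whp_no_value[of ?Lo ?Hi, unfolded card, OF sub(4,5) lim_card(5)]
      whp_no_value[of ?Hi ?Lo, unfolded card, OF sub(5,4) lim_card(5)]
    by (intro whp_conj)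
  have wide: "whp ?wide"
    using whp_many_values[of ?lo ?lo, unfolded card, OF sub(2,2) lim_card(1)]
      whp_many_values[of ?hi ?hi, unfolded card, OF sub(3,3) lim_card(1)]
    by (intro whp_conj)
  have narrow: "whp ?narrow"
    using whp_many_values[of ?Lo ?M, unfolded card, OF sub(4,1) lim_card(2)]
      whp_many_values[of ?Hi ?M, unfolded card, OF sub(5,1) lim_card(2)]
      whp_many_values[of ?M ?Lo, unfolded card, OF sub(1,4) lim_card(3)]
      whp_many_values[of ?M ?Hi, unfolded card, OF sub(1,5) lim_card(3)]
    by (intro whp_conj)
  have mid: "whp ?mid"
    using whp_many_values[of ?M ?M, unfolded card, OF sub(1,1) lim_card(4)] .
  have order: "\<forall>\<^sub>F n in sequentially. narrow n \<le> wide n" "\<forall>\<^sub>F n in sequentially. wide n \<le> n div 3"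
    "\<forall>\<^sub>F n in sequentially. 0 < decr_bound (wide n)" "\<forall>\<^sub>F n in sequentially. 0 < decr_bound (narrow n)"
    "\<forall>\<^sub>F n in sequentially. 0 < decr_bound n"
    unfolding wide_def narrow_def decr_bound_def by real_asymp+
  \<comment> \<open>The required sizes have orders n^0.5, n^0.4 and n^0.9, against counts of orders
    n^0.6, n^0.45 and n.\<close>
  have large: "\<forall>\<^sub>F n::nat in sequentially.
      real (k * decr_bound (wide n) + k * (k * decr_bound n)) \<le> wide n * wide n / (2 * n)"
    "\<forall>\<^sub>F n::nat in sequentially.
      real (k * decr_bound (narrow n) + k * (2 * (k * decr_bound (wide n)))) \<le> narrow n * (n div 3) / (2 * n)"
    "\<forall>\<^sub>F n::nat in sequentially.
      real ((k * 2 + k * (2 * (k * decr_bound (wide n)))) * decr_bound n) < (n div 3) * (n div 3) / (2 * n)"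
    unfolding wide_def narrow_def decr_bound_def using k by real_asymp+
  have "whp (\<lambda>n p. ?long n p \<and> ?box n p \<and> ?wide n p \<and> ?narrow n p \<and> ?mid n p)"
    by (intro whp_conj[OF long] whp_conj[OF box] whp_conj[OF wide] whp_conj[OF narrow] mid)
  then show ?thesis
  proof (rule whp_mono)
    show "\<forall>\<^sub>F n in sequentially. \<forall>p. p permutes {1..n} \<longrightarrow>
      ?long n p \<and> ?box n p \<and> ?wide n p \<and> ?narrow n p \<and> ?mid n p \<longrightarrow> (k dvd n \<longrightarrow> tiled p k {1..n})"
      using order large
    proof (eventually_elim, intro allI impI)
      fix n :: nat and p :: "nat \<Rightarrow> nat"
      assume n: "narrow n \<le> wide n" "wide n \<le> n div 3" "0 < decr_bound (wide n)"
        "0 < decr_bound (narrow n)" "0 < decr_bound n"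
        and large: "real (k * decr_bound (wide n) + k * (k * decr_bound n)) \<le> wide n * wide n / (2 * n)"
        "real (k * decr_bound (narrow n) + k * (2 * (k * decr_bound (wide n)))) \<le> narrow n * (n div 3) / (2 * n)"
        "real ((k * 2 + k * (2 * (k * decr_bound (wide n)))) * decr_bound n) < (n div 3) * (n div 3) / (2 * n)"
        and p: "p permutes {1..n}" "k dvd n"
        and E: "?long n p \<and> ?box n p \<and> ?wide n p \<and> ?narrow n p \<and> ?mid n p"
      have large': "real (k * decr_bound (narrow n) + k * (2 * (k * decr_bound (wide n)))) \<le> (n div 3) * narrow n / (2 * n)"
        using large(2) by (simp only: mult.commute)
      note E' = E[THEN conjunct1] E[THEN conjunct2, THEN conjunct1]
        E[THEN conjunct2, THEN conjunct2, THEN conjunct1]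
        E[THEN conjunct2, THEN conjunct2, THEN conjunct2, THEN conjunct1]
        E[THEN conjunct2, THEN conjunct2, THEN conjunct2, THEN conjunct2]
      have le: "x \<le> y" if "real x \<le> r" "r \<le> real y" for x y r using that by linarith
      have wide: "k * decr_bound (wide n) + k * (k * decr_bound n) \<le> card {i\<in>?lo n. p i \<in> ?lo n}"
        "k * decr_bound (wide n) + k * (k * decr_bound n) \<le> card {i\<in>?hi n. p i \<in> ?hi n}"
        using E'(3) le[OF large(1)] by blast+
      have narrow: "k * decr_bound (narrow n) + k * (2 * (k * decr_bound (wide n))) \<le> card {i\<in>?Lo n. p i \<in> ?M n}"
        "k * decr_bound (narrow n) + k * (2 * (k * decr_bound (wide n))) \<le> card {i\<in>?Hi n. p i \<in> ?M n}"
        using E'(4) le[OF large(2)] by blast+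
      have narrow': "k * decr_bound (narrow n) + k * (2 * (k * decr_bound (wide n))) \<le> card {i\<in>?M n. p i \<in> ?Lo n}"
        "k * decr_bound (narrow n) + k * (2 * (k * decr_bound (wide n))) \<le> card {i\<in>?M n. p i \<in> ?Hi n}"
        using E'(4) le[OF large'] by blast+
      have mid: "(k * 2 + k * (2 * (k * decr_bound (wide n)))) * decr_bound n < card {i\<in>?M n. p i \<in> ?M n}"
        using order_less_le_trans[OF large(3) E'(5)] by (simp only: of_nat_less_iff)
      have third: "3 * (n div 3) \<le> n" by simp
      show "tiled p k {1..n}"
        using E'(1,2) by (elim conjE) (rule tiled_atLeastAtMost[OF p(1) k p(2) n(1,2) third n(3,4,5)
          _ _ _ _ _ _ _ _ _ wide narrow narrow' mid]; assumption)
    qed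
  qed
qed

section \<open>From tilings to twins\<close>

lemma incr_on_sorted_subseq_at:
  assumes "finite A" "incr_on p A"
  shows "sorted_wrt (<) (subseq_at p A)"
  unfolding subseq_at_def sorted_wrt_map
  by (rule sorted_wrt_mono_rel[OF _ strict_sorted_list_of_set]) (use assms in \<open>auto simp: incr_on_def\<close>)

text \<open>Counting the r*k positions block by block gives exactly r blocks. Increasing sequences
  of equal length are similar, as both sides of every comparison hold.\<close>

lemma tiled_imp_twins:
  assumes "tiled p k {1..r * k}" "k > 0"
  shows "\<exists>T. twins (r * k) p r k T \<and> partition_on {1..r * k} T \<and>
    (\<forall>A\<in>T. sorted_wrt (<) (subseq_at p A))"
proof -
  obtain T where T: "partition_on {1..r * k} T" "\<forall>X\<in>T. card X = k \<and> incr_on p X"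
    using assms(1) unfolding tiled_def by blast
  have sub: "X \<subseteq> {1..r * k}" if "X \<in> T" for X using T(1) that by (auto simp: partition_on_def)
  have fin: "finite X" if "X \<in> T" for X using sub[OF that] finite_subset by blast
  have fT: "finite T" using finite_elements[OF _ T(1)] by simp
  have "card {1..r * k} = (\<Sum>X\<in>T. card X)" by (rule product_partition[OF T(1) fin])
  then have "card T = r" using T(2) assms(2) by simp
  moreover have sorted: "\<forall>A\<in>T. sorted_wrt (<) (subseq_at p A)"
    using T(2) fin incr_on_sorted_subseq_at by blast
  moreover have "similar (subseq_at p A) (subseq_at p B)" if "A \<in> T" "B \<in> T" for A B
  proof -
    have "length (subseq_at p A) = length (subseq_at p B)"
      using that T(2) by (simp add: subseq_at_def)
    then show ?thesis unfolding similar_def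
      using sorted that by (simp add: sorted_wrt_iff_nth_less)
  qed
  ultimately have "twins (r * k) p r k T"
    unfolding twins_def using fT sub T by (auto simp: partition_on_def)
  then show ?thesis using T(1) sorted by blast
qed

theorem theorem5:
  fixes k :: nat
  assumes "k > 0"
  shows "(\<lambda>r. measure_pmf.prob (random_perm (r * k))
            {p. \<exists>T. twins (r * k) p r k T \<and> partition_on {1..r * k} T \<and>
                    (\<forall>A\<in>T. sorted_wrt (<) (subseq_at p A))})
         \<longlonglongrightarrow> 1"
proof (rule tendsto_sandwich[OF _ _ _ tendsto_const])
  \<comment> \<open>The multiples of \<open>k\<close> form a subsequence along which the
    divisibility premise of \<open>whp_tiled\<close> is always true.\<close>
  have "filterlim (\<lambda>r. r * k) at_top sequentially"
    using assms by (simp add: filterlim_subseq strict_mono_def)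
  from filterlim_compose[OF whp_tiled[OF assms, unfolded whp_def] this]
  have "(\<lambda>r. measure_pmf.prob (random_perm (r * k)) {p. \<not> tiled p k {1..r * k}}) \<longlonglongrightarrow> 0"
    by simp
  from tendsto_diff[OF tendsto_const[of 1] this]
  show "(\<lambda>r. 1 - measure_pmf.prob (random_perm (r * k)) {p. \<not> tiled p k {1..r * k}}) \<longlonglongrightarrow> 1"
    by simp
  show "\<forall>\<^sub>F r in sequentially. 1 - measure_pmf.prob (random_perm (r * k)) {p. \<not> tiled p k {1..r * k}}
    \<le> measure_pmf.prob (random_perm (r * k))
            {p. \<exists>T. twins (r * k) p r k T \<and> partition_on {1..r * k} T \<and>
                    (\<forall>A\<in>T. sorted_wrt (<) (subseq_at p A))}"
  proof (rule always_eventually, rule allI)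
    fix r
    have "1 - measure_pmf.prob (random_perm (r * k)) {p. \<not> tiled p k {1..r * k}}
      = measure_pmf.prob (random_perm (r * k)) {p. tiled p k {1..r * k}}"
      using measure_pmf.prob_compl[of "{p. \<not> tiled p k {1..r * k}}" "random_perm (r * k)"]
      by (simp add: Compl_eq_Diff_UNIV[symmetric] Collect_neg_eq[symmetric])
    also have "\<dots> \<le> measure_pmf.prob (random_perm (r * k))
            {p. \<exists>T. twins (r * k) p r k T \<and> partition_on {1..r * k} T \<and>
                    (\<forall>A\<in>T. sorted_wrt (<) (subseq_at p A))}"
      by (rule measure_pmf.finite_measure_mono) (use tiled_imp_twins assms in auto)
    finally show "1 - measure_pmf.prob (random_perm (r * k)) {p. \<not> tiled p k {1..r * k}}
      \<le> measure_pmf.prob (random_perm (r * k))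
            {p. \<exists>T. twins (r * k) p r k T \<and> partition_on {1..r * k} T \<and>
                    (\<forall>A\<in>T. sorted_wrt (<) (subseq_at p A))}" .
  qed
qed auto

end
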